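(* Let $G$ be the Tanner graph of an (in general irregular) LDPC code, let $\delta$ be the minimum degree of the variable nodes of $G$, and suppose $G$ has girth $8$. Then every $(a,b)$ elementary trapping set in $G$ with $\frac{b}{a}<1$ satisfies $a\geq 2\delta-1$.
   Context: A Tanner graph is a finite simple bipartite graph with vertex classes $V$ (variable nodes) and $C$ (check nodes); for an irregular LDPC code the variable nodes may have different degrees. The girth is the length of a shortest cycle. For a nonempty subset $S\subseteq V$ with $|S|=a$, consider the subgraph of the Tanner graph induced by $S$ together with all check nodes adjacent to some element of $S$; if exactly $b$ of these check nodes have odd degree in this subgraph, it is called an $(a,b)$ trapping set of size $a$. It is an elementary trapping set (ETS) if every one of these check nodes has degree $1$ or $2$ in the subgraph (so $b$ is the number of degree-one check nodes). *)

theory Defs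
  imports "Graph_Theory.Graph_Theory" "HOL-Library.Extended_Nat"
begin

text \<open>
  A finite simple undirected graph is the locale \<open>graph\<close> of \<open>Graph_Theory\<close>: a finite symmetric
  digraph without loops or parallel arcs, each undirected edge being a pair of opposite arcs.
  Hence the degree of a vertex in the undirected graph is its \<open>out_degree\<close>.
\<close>

locale tanner_graph = graph G for G :: "('a, 'b) pre_digraph" (structure) +
  fixes V C :: "'a set"
  assumes verts_eq: "verts G = V \<union> C"
    and classes_disjoint: "V \<inter> C = {}"
    and bipartite: "e \<in> arcs G \<Longrightarrow>
      tail G e \<in> V \<and> head G e \<in> C \<or> tail G e \<in> C \<and> head G e \<in> V"

text \<open>
  The library's \<open>cycle\<close> is that of digraphs, so it also admits \<open>u, v, u\<close> along the two opposite
  arcs of a single edge. In a simple graph, the cycles with at least three arcs are exactly the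
  undirected ones.
\<close>

definition undirected_cycle :: "('a, 'b) pre_digraph \<Rightarrow> 'b list \<Rightarrow> bool" where
  "undirected_cycle G p \<longleftrightarrow> pre_digraph.cycle G p \<and> 3 \<le> length p"

text \<open>The girth of an acyclic graph is \<open>\<infinity>\<close>.\<close>

definition girth :: "('a, 'b) pre_digraph \<Rightarrow> enat" where
  "girth G = (INF p \<in> {p. undirected_cycle G p}. enat (length p))"

definition min_variable_degree :: "('a, 'b) pre_digraph \<Rightarrow> 'a set \<Rightarrow> nat" where
  "min_variable_degree G V = Min (out_degree G ` V)"

definition adjacent_checks :: "('a, 'b) pre_digraph \<Rightarrow> 'a set \<Rightarrow> 'a set \<Rightarrow> 'a set" where
  "adjacent_checks G C S = {c \<in> C. \<exists>v \<in> S. v \<rightarrow>\<^bsub>G\<^esub> c}"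

definition trapping_subgraph ::
    "('a, 'b) pre_digraph \<Rightarrow> 'a set \<Rightarrow> 'a set \<Rightarrow> ('a, 'b) pre_digraph" where
  "trapping_subgraph G C S = G \<restriction> (S \<union> adjacent_checks G C S)"

definition trapping_set ::
    "('a, 'b) pre_digraph \<Rightarrow> 'a set \<Rightarrow> 'a set \<Rightarrow> nat \<Rightarrow> nat \<Rightarrow> 'a set \<Rightarrow> bool" where
  "trapping_set G V C a b S \<longleftrightarrow>
     S \<subseteq> V \<and> S \<noteq> {} \<and> card S = a \<and>
     card {c \<in> adjacent_checks G C S. odd (out_degree (trapping_subgraph G C S) c)} = b"

definition elementary_trapping_set ::
    "('a, 'b) pre_digraph \<Rightarrow> 'a set \<Rightarrow> 'a set \<Rightarrow> nat \<Rightarrow> nat \<Rightarrow> 'a set \<Rightarrow> bool" where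
  "elementary_trapping_set G V C a b S \<longleftrightarrow>
     trapping_set G V C a b S \<and>
     (\<forall>c \<in> adjacent_checks G C S. out_degree (trapping_subgraph G C S) c \<in> {1, 2})"

end

theory Submission
  imports Defs "HOL-Analysis.Convex"
begin

text \<open>
  Join two variable nodes of \<open>S\<close> when they share a check node. Since the girth exceeds 6, the
  resulting graph on \<open>S\<close> is simple and triangle-free; a variable node has in it at least its
  degree in \<open>G\<close> minus the number of its degree-one check nodes. Hence its degree sum exceeds
  \<open>a(\<delta> - 1)\<close>, whereas Mantel's theorem bounds it by \<open>a\<^sup>2/2\<close>.
\<close>

text \<open>
  Mantel's theorem for a graph given by its neighbourhoods: the degrees at the ends of an edge add
  up to at most \<open>card S\<close>; summing over all edges yields the squares of the degrees, which
  Cauchy-Schwarz bounds from below.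
\<close>

lemma triangle_free_degree_sum_le:
  fixes S :: "'a set" and N :: "'a \<Rightarrow> 'a set"
  assumes fin: "finite S"
    and sub: "\<And>v. v \<in> S \<Longrightarrow> N v \<subseteq> S"
    and sym: "\<And>u v. v \<in> S \<Longrightarrow> u \<in> N v \<Longrightarrow> v \<in> N u"
    and triangle_free: "\<And>u v. v \<in> S \<Longrightarrow> u \<in> N v \<Longrightarrow> N u \<inter> N v = {}"
  shows "2 * (\<Sum>v\<in>S. card (N v)) \<le> (card S)\<^sup>2"
proof -
  define d where "d v = card (N v)" for v
  define D where "D = (\<Sum>v\<in>S. d v)"
  have finN: "finite (N v)" if "v \<in> S" for v
    using that sub fin finite_subset by blast
  \<comment> \<open>Written as a filter of \<open>S\<close> so that \<open>sum.swap_restrict\<close>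
    applies.\<close>
  have N_eq: "N v = {u \<in> S. u \<in> N v}" if "v \<in> S" for v
    using that sub by blast
  have edge: "d v + d u \<le> card S" if "v \<in> S" "u \<in> N v" for u v
  proof -
    have "u \<in> S" using that sub by blast
    then have "d v + d u = card (N v \<union> N u)"
      using that finN triangle_free[OF that] unfolding d_def
      by (subst card_Un_disjoint) auto
    also have "\<dots> \<le> card S"
      using that sub \<open>u \<in> S\<close> fin by (intro card_mono) auto
    finally show ?thesis .
  qed
  have swap: "(\<Sum>v\<in>S. \<Sum>u\<in>N v. d u) = (\<Sum>v\<in>S. d v * d v)"
  proof -
    have "(\<Sum>v\<in>S. \<Sum>u\<in>N v. d u) = (\<Sum>v\<in>S. \<Sum>u\<in>{u \<in> S. u \<in> N v}. d u)"
      using N_eq by (intro sum.cong) auto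
    also have "\<dots> = (\<Sum>u\<in>S. \<Sum>v\<in>{v \<in> S. u \<in> N v}. d u)"
      using fin by (rule sum.swap_restrict[OF _ fin])
    also have "\<dots> = (\<Sum>u\<in>S. \<Sum>v\<in>N u. d u)"
    proof (intro sum.cong refl)
      show "{v \<in> S. u \<in> N v} = N u" if "u \<in> S" for u
        using that sym sub by blast
    qed
    finally show ?thesis by (simp add: d_def)
  qed
  \<comment> \<open>The right-hand sum runs over ordered pairs of neighbours; \<open>d v\<close> and
    \<open>d u\<close> each contribute one copy of the sum of squares, the latter by
    \<open>swap\<close>.\<close>
  have "2 * (\<Sum>v\<in>S. d v * d v) = (\<Sum>v\<in>S. \<Sum>u\<in>N v. d v + d u)"
    unfolding sum.distrib swap by (simp add: d_def)
  also have "\<dots> \<le> (\<Sum>v\<in>S. \<Sum>u\<in>N v. card S)"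
    using edge by (intro sum_mono) auto
  also have "\<dots> = card S * D"
    by (simp add: d_def D_def sum_distrib_left mult.commute)
  finally have "2 * (\<Sum>v\<in>S. d v * d v) \<le> card S * D" .
  moreover have "D * D \<le> card S * (\<Sum>v\<in>S. d v * d v)"
  proof -
    have "(\<Sum>v\<in>S. real (d v))\<^sup>2 \<le> (\<Sum>v\<in>S. (real (d v))\<^sup>2) * real (card S)"
      by (rule sum_squared_le_sum_of_squares)
    then have "real (D * D) \<le> real (card S * (\<Sum>v\<in>S. d v * d v))"
      by (simp add: D_def power2_eq_square mult.commute)
    then show ?thesis by linarith
  qed
  ultimately have "2 * (D * D) \<le> card S * (card S * D)"
    using mult_le_mono2[of "2 * (\<Sum>v\<in>S. d v * d v)" "card S * D" "card S"] by linarith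
  then have "D * (2 * D) \<le> D * (card S)\<^sup>2"
    by (simp add: power2_eq_square ac_simps)
  \<comment> \<open>Cancelling \<open>D\<close> needs it to be nonzero; for \<open>D = 0\<close> the
    claim is trivial.\<close>
  then have "2 * D \<le> (card S)\<^sup>2"
    by (cases "D = 0") auto
  then show ?thesis
    by (simp add: D_def d_def)
qed

section \<open>Degrees as numbers of neighbours\<close>

lemma (in nomulti_digraph) out_degree_eq_card_dominated:
  "out_degree G u = card {w. u \<rightarrow>\<^bsub>G\<^esub> w}"
proof -
  have "{w. u \<rightarrow>\<^bsub>G\<^esub> w} = head G ` out_arcs G u"
    by (auto simp: arcs_ends_conv)
  moreover have "inj_on (head G) (out_arcs G u)"
    by (rule inj_onI) (auto intro: no_multi_arcs simp: arc_to_ends_def)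
  ultimately show ?thesis
    by (simp add: out_degree_def card_image)
qed

lemma (in nomulti_digraph) out_degree_induce_subgraph:
  assumes "u \<in> X"
  shows "out_degree (G \<restriction> X) u = card {w \<in> X. u \<rightarrow>\<^bsub>G\<^esub> w}"
proof -
  interpret H: nomulti_digraph "G \<restriction> X"
    by unfold_locales (auto intro: no_multi_arcs simp: arc_to_ends_def)
  have "{w. u \<rightarrow>\<^bsub>G \<restriction> X\<^esub> w} = {w \<in> X. u \<rightarrow>\<^bsub>G\<^esub> w}"
    using assms by (auto simp: arcs_ends_conv)
  then show ?thesis
    by (simp add: H.out_degree_eq_card_dominated)
qed

section \<open>Short cycles and the girth\<close>

lemma girth_le:
  assumes "undirected_cycle G p"
  shows "girth G \<le> enat (length p)"
  unfolding girth_def using assms by (intro INF_lower) simp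

context graph
begin

lemma dominates_sym: "u \<rightarrow>\<^bsub>G\<^esub> v \<Longrightarrow> v \<rightarrow>\<^bsub>G\<^esub> u"
  using sym_arcs by (auto simp: symmetric_def dest: symD)

text \<open>Serves to exclude two variable nodes with two common check nodes. Distinctness of the
  vertices makes the closed walk along the four arcs a cycle.\<close>

lemma girth_le_4:
  assumes arcs: "u \<rightarrow>\<^bsub>G\<^esub> c" "c \<rightarrow>\<^bsub>G\<^esub> v" "v \<rightarrow>\<^bsub>G\<^esub> d" "d \<rightarrow>\<^bsub>G\<^esub> u"
    and distinct: "distinct [u, c, v, d]"
  shows "girth G \<le> 4"
proof -
  obtain e1 e2 e3 e4 where e: "e1 \<in> arcs G" "tail G e1 = u" "head G e1 = c"
    "e2 \<in> arcs G" "tail G e2 = c" "head G e2 = v"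
    "e3 \<in> arcs G" "tail G e3 = v" "head G e3 = d"
    "e4 \<in> arcs G" "tail G e4 = d" "head G e4 = u"
    using arcs by (auto simp: arcs_ends_conv)
  have "cycle [e1, e2, e3, e4]"
    unfolding cycle_def using e distinct
    by (intro exI[of _ u]) (auto simp: awalk_simps intro: wellformed)
  then have "undirected_cycle G [e1, e2, e3, e4]"
    by (simp add: undirected_cycle_def)
  from girth_le[OF this] have "girth G \<le> enat 4"
    by (simp add: eval_nat_numeral)
  then show ?thesis
    by (simp only: numeral_eq_enat)
qed

text \<open>Serves to exclude three variable nodes joined pairwise by three different check
  nodes.\<close>

lemma girth_le_6:
  assumes arcs: "u \<rightarrow>\<^bsub>G\<^esub> c" "c \<rightarrow>\<^bsub>G\<^esub> v" "v \<rightarrow>\<^bsub>G\<^esub> d" "d \<rightarrow>\<^bsub>G\<^esub> w" "w \<rightarrow>\<^bsub>G\<^esub> e" "e \<rightarrow>\<^bsub>G\<^esub> u"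
    and distinct: "distinct [u, c, v, d, w, e]"
  shows "girth G \<le> 6"
proof -
  obtain e1 e2 e3 e4 e5 e6 where e: "e1 \<in> arcs G" "tail G e1 = u" "head G e1 = c"
    "e2 \<in> arcs G" "tail G e2 = c" "head G e2 = v"
    "e3 \<in> arcs G" "tail G e3 = v" "head G e3 = d"
    "e4 \<in> arcs G" "tail G e4 = d" "head G e4 = w"
    "e5 \<in> arcs G" "tail G e5 = w" "head G e5 = e"
    "e6 \<in> arcs G" "tail G e6 = e" "head G e6 = u"
    using arcs by (auto simp: arcs_ends_conv)
  have "cycle [e1, e2, e3, e4, e5, e6]"
    unfolding cycle_def using e distinct
    by (intro exI[of _ u]) (auto simp: awalk_simps intro: wellformed)
  then have "undirected_cycle G [e1, e2, e3, e4, e5, e6]"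
    by (simp add: undirected_cycle_def)
  from girth_le[OF this] have "girth G \<le> enat 6"
    by (simp add: eval_nat_numeral)
  then show ?thesis
    by (simp only: numeral_eq_enat)
qed

end

section \<open>Trapping sets in a Tanner graph\<close>

context tanner_graph
begin

lemma dominates_V: "v \<in> V \<Longrightarrow> v \<rightarrow>\<^bsub>G\<^esub> c \<Longrightarrow> c \<in> C"
  using bipartite classes_disjoint by (fastforce simp: arcs_ends_conv)

lemma dominates_C: "c \<in> C \<Longrightarrow> c \<rightarrow>\<^bsub>G\<^esub> v \<Longrightarrow> v \<in> V"
  using bipartite classes_disjoint by (fastforce simp: arcs_ends_conv)

text \<open>By bipartiteness all neighbours of a check node are variable nodes, so the check nodes
  kept in the subgraph add nothing to its degree.\<close>

lemma out_degree_trapping_subgraph: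
  assumes "S \<subseteq> V" "c \<in> adjacent_checks G C S"
  shows "out_degree (trapping_subgraph G C S) c = card {v \<in> S. v \<rightarrow>\<^bsub>G\<^esub> c}"
proof -
  have "c \<in> C"
    using assms by (simp add: adjacent_checks_def)
  then have "{w \<in> S \<union> adjacent_checks G C S. c \<rightarrow>\<^bsub>G\<^esub> w} = {v \<in> S. v \<rightarrow>\<^bsub>G\<^esub> c}"
    using assms dominates_C classes_disjoint dominates_sym
    by (auto simp: adjacent_checks_def)
  then show ?thesis
    using assms by (simp add: trapping_subgraph_def out_degree_induce_subgraph)
qed

text \<open>The bound has the form \<open>a + 1\<close> on the right to avoid truncated subtraction
  on naturals.\<close>

lemma elementary_trapping_set_size:
  assumes girth: "6 < girth G"
    and ets: "elementary_trapping_set G V C a b S"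
    and "b < a"
  shows "2 * min_variable_degree G V \<le> a + 1"
proof -
  have S: "S \<subseteq> V" "card S = a" "S \<noteq> {}"
    using ets by (auto simp: elementary_trapping_set_def trapping_set_def)
  have finV: "finite V"
    using finite_verts verts_eq by simp
  then have finS: "finite S"
    using S finite_subset by blast
  define A where "A = adjacent_checks G C S"
  define nb where "nb c = {v \<in> S. v \<rightarrow>\<^bsub>G\<^esub> c}" for c
  have finnb: "finite (nb c)" for c
    using finS by (simp add: nb_def)
  have inA: "c \<in> A" if "v \<in> S" "v \<rightarrow>\<^bsub>G\<^esub> c" for v c
    using that S dominates_V by (auto simp: A_def adjacent_checks_def)
  have deg: "card (nb c) = 1 \<or> card (nb c) = 2" if "c \<in> A" for c
    using ets that out_degree_trapping_subgraph[OF S(1)]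
    by (auto simp: elementary_trapping_set_def A_def nb_def)
  have b: "card {c \<in> A. odd (card (nb c))} = b"
  proof -
    have "{c \<in> A. odd (card (nb c))} =
        {c \<in> adjacent_checks G C S. odd (out_degree (trapping_subgraph G C S) c)}"
      using out_degree_trapping_subgraph[OF S(1)] by (auto simp: A_def nb_def)
    then show ?thesis
      using ets by (simp add: elementary_trapping_set_def trapping_set_def)
  qed
  have finA: "finite A"
    using finite_verts verts_eq by (auto simp: A_def adjacent_checks_def)
  define N where "N v = {w \<in> S. w \<noteq> v \<and> (\<exists>c. v \<rightarrow>\<^bsub>G\<^esub> c \<and> w \<rightarrow>\<^bsub>G\<^esub> c)}" for v
  define B where "B v = {c. v \<rightarrow>\<^bsub>G\<^esub> c \<and> card (nb c) = 1}" for v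
  \<comment> \<open>The node \<open>w\<close>, possibly equal to \<open>v\<close>, only witnesses
    that \<open>c\<close> is a check node.\<close>
  have neq: "v \<noteq> c" if "v \<in> S" "w \<in> S" "w \<rightarrow>\<^bsub>G\<^esub> c" for v w c
    using that S dominates_V classes_disjoint by blast
  have common_unique: "c = d"
    if "u \<in> S" "v \<in> S" "u \<noteq> v" "u \<rightarrow>\<^bsub>G\<^esub> c" "v \<rightarrow>\<^bsub>G\<^esub> c" "u \<rightarrow>\<^bsub>G\<^esub> d" "v \<rightarrow>\<^bsub>G\<^esub> d" for u v c d
  proof (rule ccontr)
    assume "c \<noteq> d"
    then have "distinct [u, c, v, d]"
      using that neq[of u u c] neq[of u u d] neq[of v u c] neq[of v u d] by auto
    then have "girth G \<le> 4"
      using that dominates_sym by (intro girth_le_4[of u c v d]) auto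
    also have "\<dots> < 6" by (simp add: numeral_eq_enat)
    finally show False using girth by simp
  qed
  \<comment> \<open>In an elementary trapping set a check node has at most two neighbours in
    \<open>S\<close>.\<close>
  have three: False
    if "u \<in> S" "v \<in> S" "w \<in> S" "distinct [u, v, w]" "u \<rightarrow>\<^bsub>G\<^esub> c" "v \<rightarrow>\<^bsub>G\<^esub> c" "w \<rightarrow>\<^bsub>G\<^esub> c" for u v w c
  proof -
    have "{u, v, w} \<subseteq> nb c" using that by (simp add: nb_def)
    then have "card {u, v, w} \<le> card (nb c)" by (rule card_mono[OF finnb])
    then show False using that deg[OF inA, of u c] by auto
  qed
  have "2 * (\<Sum>v\<in>S. card (N v)) \<le> (card S)\<^sup>2"
  proof (rule triangle_free_degree_sum_le[OF finS])
    show "N u \<inter> N v = {}" if v: "v \<in> S" "u \<in> N v" for u v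
    proof (rule ccontr)
      assume "N u \<inter> N v \<noteq> {}"
      then obtain w where "w \<in> N u" "w \<in> N v" by blast
      then obtain c d e where
        c: "v \<rightarrow>\<^bsub>G\<^esub> c" "u \<rightarrow>\<^bsub>G\<^esub> c" and d: "u \<rightarrow>\<^bsub>G\<^esub> d" "w \<rightarrow>\<^bsub>G\<^esub> d" and e: "w \<rightarrow>\<^bsub>G\<^esub> e" "v \<rightarrow>\<^bsub>G\<^esub> e"
        and uw: "u \<in> S" "w \<in> S" "distinct [u, v, w]"
        using v by (auto simp: N_def)
      \<comment> \<open>If two of these check nodes coincided, that node would be adjacent to all of
        \<open>u\<close>, \<open>v\<close> and \<open>w\<close>.\<close>
      have "c \<noteq> d" "d \<noteq> e" "e \<noteq> c"
        using three[OF uw(1) v(1) uw(2,3)] c d e by metis+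
      then have "distinct [v, c, u, d, w, e]"
        using uw v neq[OF _ v(1) c(1)] neq[OF _ uw(1) d(1)] neq[OF _ uw(2) e(1)] by auto
      then have "girth G \<le> 6"
        using c d e dominates_sym by (intro girth_le_6[of v c u d w e]) auto
      then show False using girth by simp
    qed
  qed (auto simp: N_def)
  moreover have "out_degree G v \<le> card (N v) + card (B v)" if v: "v \<in> S" for v
  proof -
    define D where "D = {c. v \<rightarrow>\<^bsub>G\<^esub> c \<and> card (nb c) = 2}"
    have "{c. v \<rightarrow>\<^bsub>G\<^esub> c} = D \<union> B v"
      using deg inA v by (auto simp: D_def B_def)
    then have "out_degree G v \<le> card D + card (B v)"
      by (simp add: out_degree_eq_card_dominated card_Un_le)
    \<comment> \<open>Each degree-two check node at \<open>v\<close> leads to a second node of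
      \<open>S\<close>. By \<open>common_unique\<close>, different check nodes lead to different
      nodes.\<close>
    also have "card D \<le> card (N v)"
    proof (rule card_le_if_inj_on_rel[where r = "\<lambda>c w. w \<rightarrow>\<^bsub>G\<^esub> c"])
      show "finite (N v)" using finS by (simp add: N_def)
      show "\<exists>w. w \<in> N v \<and> w \<rightarrow>\<^bsub>G\<^esub> c" if "c \<in> D" for c
      proof -
        have "card (nb c) = 2" "v \<rightarrow>\<^bsub>G\<^esub> c" using that by (auto simp: D_def)
        then obtain w where "w \<in> nb c" "w \<noteq> v"
          by (metis card_2_iff')
        then show ?thesis
          using \<open>v \<rightarrow>\<^bsub>G\<^esub> c\<close> by (auto simp: N_def nb_def)
      qed
      show "c = d" if "c \<in> D" "d \<in> D" "w \<in> N v" "w \<rightarrow>\<^bsub>G\<^esub> c" "w \<rightarrow>\<^bsub>G\<^esub> d" for c d w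
        using that v by (intro common_unique[of v w]) (auto simp: D_def N_def)
    qed
    finally show ?thesis by simp
  qed
  then have "(\<Sum>v\<in>S. out_degree G v) \<le> (\<Sum>v\<in>S. card (N v)) + (\<Sum>v\<in>S. card (B v))"
    by (simp add: sum.distrib[symmetric] sum_mono)
  \<comment> \<open>The sets \<open>B v\<close> are disjoint, since a check node of degree one has a
    single neighbour in \<open>S\<close>, and all their elements are among the \<open>b\<close>
    check nodes of odd degree.\<close>
  moreover have "(\<Sum>v\<in>S. card (B v)) \<le> b"
  proof -
    have BA: "B v \<subseteq> {c \<in> A. odd (card (nb c))}" if "v \<in> S" for v
      using that inA by (auto simp: B_def)
    have finB: "finite (B v)" if "v \<in> S" for v
      by (rule finite_subset[OF BA[OF that]]) (simp add: finA)
    have "B v \<inter> B w = {}" if "v \<in> S" "w \<in> S" "v \<noteq> w" for v w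
    proof -
      have "card (nb c) \<noteq> 1" if "v \<rightarrow>\<^bsub>G\<^esub> c" "w \<rightarrow>\<^bsub>G\<^esub> c" for c
      proof -
        have "v \<in> nb c" "w \<in> nb c"
          using that \<open>v \<in> S\<close> \<open>w \<in> S\<close> by (auto simp: nb_def)
        then show ?thesis
          using \<open>v \<noteq> w\<close> by (metis card_1_singletonE singletonD)
      qed
      then show ?thesis by (auto simp: B_def)
    qed
    then have "(\<Sum>v\<in>S. card (B v)) = card (\<Union>v\<in>S. B v)"
      using finS finB by (intro card_UN_disjoint[symmetric]) auto
    also have "\<dots> \<le> card {c \<in> A. odd (card (nb c))}"
      using BA finA by (intro card_mono) auto
    finally show ?thesis using b by simp
  qed
  moreover have "a * min_variable_degree G V \<le> (\<Sum>v\<in>S. out_degree G v)"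
  proof -
    have "min_variable_degree G V \<le> out_degree G v" if "v \<in> S" for v
      unfolding min_variable_degree_def using that S finV by (intro Min_le) auto
    then show ?thesis
      using sum_bounded_below[of S "min_variable_degree G V" "out_degree G"] S by simp
  qed
  \<comment> \<open>Writing \<delta> for the minimum degree, the collected bounds give 2a\<delta>
    \<le> a^2 + 2b, and b < a makes this strictly less than a^2 + 2a.\<close>
  ultimately have "a * (2 * min_variable_degree G V) < a * (a + 2)"
    using \<open>b < a\<close> S(2) by (simp add: power2_eq_square)
  then have "2 * min_variable_degree G V < a + 2"
    by (simp only: mult_less_cancel1)
  then show ?thesis by simp
qed

end

theorem mainTheorem4:
  fixes G :: "('a, 'b) pre_digraph" and V C S :: "'a set" and a b \<delta> :: nat
  assumes "tanner_graph G V C"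
    and "\<delta> = min_variable_degree G V"
    and "girth G = 8"
    and "elementary_trapping_set G V C a b S"
    and "real b / real a < 1"
  shows "int a \<ge> 2 * int \<delta> - 1"
proof -
  interpret tanner_graph G V C by fact
  have "finite S"
    using assms(4) finite_verts verts_eq finite_subset
    by (auto simp: elementary_trapping_set_def trapping_set_def)
  \<comment> \<open>Division by zero yields 0, so for \<open>a = 0\<close> the ratio would be below
    1 whatever \<open>b\<close> is; positivity turns the ratio bound into
    \<open>b < a\<close>.\<close>
  then have "a > 0"
    using assms(4) by (auto simp: elementary_trapping_set_def trapping_set_def card_gt_0_iff)
  then have "b < a"
    using assms(5) by simp
  moreover have "6 < girth G"
    using assms(3) by (simp add: numeral_eq_enat)
  ultimately show ?thesis
    using elementary_trapping_set_size[OF _ assms(4)] assms(2) by linarith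
qed

end
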